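(* Let $d\geq 2$ and let $\mathcal{R}$ and $\mathcal{B}$ be independent Poisson processes of intensity $1$ in $\mathbb{R}^d$. Any translation-invariant minimal matching scheme of $\mathcal{R}$ to $\mathcal{B}$ must be locally finite.
   Context: For a simple point process $\Pi$, its support is the random set $[\Pi]:=\{x:\Pi(\{x\})=1\}$. Points of $[\mathcal{R}]$ are called red points and points of $[\mathcal{B}]$ blue points. A matching scheme of $\mathcal{R}$ to $\mathcal{B}$ is a simple point process $\mathcal{M}$ in $(\mathbb{R}^d)^2$, defined jointly with $\mathcal{R},\mathcal{B}$ on some probability space (so $\mathcal{M}$ may use additional randomness), such that almost surely the graph with vertex set $[\mathcal{R}]\cup[\mathcal{B}]$ and edge set $[\mathcal{M}]$ is a perfect matching of $[\mathcal{R}]$ to $[\mathcal{B}]$, i.e. a bipartite graph with vertex classes $[\mathcal{R}],[\mathcal{B}]$ and all degrees equal to $1$; an edge is written $(r,b)\in[\mathcal{M}]$ with $r$ red and $b$ blue. It is translation-invariant if the law of $(\mathcal{R},\mathcal{B},\mathcal{M})$ is invariant under all translations of $\mathbb{R}^d$. It is minimal if a.s., for any finite set of edges $\{(r_i,b_i)\}_{i=1,\ldots,n}\subset[\mathcal{M}]$ (with $r_i\in[\mathcal{R}]$, $b_i\in[\mathcal{B}]$), $\sum_i|r_i-b_i|=\min_\sigma\sum_i|r_i-b_{\sigma(i)}|$, where the minimum is over all permutations $\sigma$ of $1,\ldots,n$ and $|\cdot|$ is the Euclidean norm. An edge $(r,b)\in[\mathcal{M}]$ crosses a set $S\subset\mathbb{R}^d$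 if the closed line segment from $r$ to $b$ intersects $S$. A matching scheme is locally finite if a.s. every bounded set $S\subset\mathbb{R}^d$ is crossed by only finitely many edges. *)

theory Defs
  imports "HOL-Probability.Probability" "HOL-Combinatorics.Permutations"
begin

definition counting_measures :: "'a::euclidean_space measure set" where
  "counting_measures =
    {N. sets N = sets borel \<and>
        (\<forall>A\<in>sets borel. bounded A \<longrightarrow> (\<exists>k::nat. emeasure N A = of_nat k))}"

text \<open>The \<open>\<sigma>\<close>-algebra generated by the evaluations \<open>N \<mapsto> N A\<close> for Borel \<open>A\<close>.\<close>

definition config_space :: "'a::euclidean_space measure measure" where
  "config_space = sigma counting_measures
    {{N \<in> counting_measures. emeasure N A \<in> U} | A U.
       A \<in> sets borel \<and> U \<in> sets borel}"

definition point_process :: "'w measure \<Rightarrow> ('w \<Rightarrow> 'a::euclidean_space measure) \<Rightarrow> bool" where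
  "point_process P N \<longleftrightarrow> N \<in> measurable P config_space"

definition simple_point_process :: "'w measure \<Rightarrow> ('w \<Rightarrow> 'a::euclidean_space measure) \<Rightarrow> bool" where
  "simple_point_process P N \<longleftrightarrow>
    point_process P N \<and> (AE w in P. \<forall>x. emeasure (N w) {x} \<le> 1)"

definition support :: "'a measure \<Rightarrow> 'a set" where
  "support N = {x. emeasure N {x} = 1}"

text \<open>The Poisson weights are written out because a set of volume zero (mean zero) must be
  allowed, whereas \<open>poisson_pmf\<close> requires a positive rate. Simplicity is a consequence.\<close>

definition poisson_process ::
  "'w measure \<Rightarrow> real \<Rightarrow> ('w \<Rightarrow> 'a::euclidean_space measure) \<Rightarrow> bool" where
  "poisson_process P lam N \<longleftrightarrow>
    point_process P N \<and>
    (\<forall>A\<in>sets borel. emeasure lborel A < \<infinity> \<longrightarrow>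
      (\<forall>k::nat. measure P {w \<in> space P. emeasure (N w) A = of_nat k} =
        exp (- (lam * measure lborel A)) * (lam * measure lborel A) ^ k / fact k)) \<and>
    (\<forall>(n::nat) A. (\<forall>i<n. A i \<in> sets borel) \<and> disjoint_family_on A {..<n} \<longrightarrow>
      prob_space.indep_vars P (\<lambda>_. borel) (\<lambda>i w. emeasure (N w) (A i)) {..<n})"

definition perfect_matching :: "'a set \<Rightarrow> 'a set \<Rightarrow> ('a \<times> 'a) set \<Rightarrow> bool" where
  "perfect_matching V W E \<longleftrightarrow>
    V \<inter> W = {} \<and> E \<subseteq> V \<times> W \<and>
    (\<forall>v \<in> V \<union> W. card {e \<in> E. v = fst e \<or> v = snd e} = 1)"

definition matching_scheme ::
  "'w measure \<Rightarrow> ('w \<Rightarrow> 'a::euclidean_space measure) \<Rightarrow> ('w \<Rightarrow> 'a measure)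
    \<Rightarrow> ('w \<Rightarrow> ('a \<times> 'a) measure) \<Rightarrow> bool" where
  "matching_scheme P R B M \<longleftrightarrow>
    simple_point_process P M \<and>
    (AE w in P. perfect_matching (support (R w)) (support (B w)) (support (M w)))"

definition translate :: "'a::euclidean_space \<Rightarrow> 'a measure \<Rightarrow> 'a measure" where
  "translate t N = distr N borel (\<lambda>x. x + t)"

definition translation_invariant ::
  "'w measure \<Rightarrow> ('w \<Rightarrow> 'a::euclidean_space measure) \<Rightarrow> ('w \<Rightarrow> 'a measure)
    \<Rightarrow> ('w \<Rightarrow> ('a \<times> 'a) measure) \<Rightarrow> bool" where
  "translation_invariant P R B M \<longleftrightarrow>
    (\<forall>t. distr P (config_space \<Otimes>\<^sub>M config_space \<Otimes>\<^sub>M config_space)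
            (\<lambda>w. (translate t (R w), translate t (B w), translate (t, t) (M w))) =
         distr P (config_space \<Otimes>\<^sub>M config_space \<Otimes>\<^sub>M config_space)
            (\<lambda>w. (R w, B w, M w)))"

definition minimal_edges :: "('a::euclidean_space \<times> 'a) set \<Rightarrow> bool" where
  "minimal_edges E \<longleftrightarrow>
    (\<forall>(n::nat) r b. inj_on (\<lambda>i. (r i, b i)) {1..n} \<and> (\<forall>i\<in>{1..n}. (r i, b i) \<in> E) \<longrightarrow>
      (\<Sum>i=1..n. norm (r i - b i)) =
      Min ((\<lambda>\<sigma>. \<Sum>i=1..n. norm (r i - b (\<sigma> i))) ` {\<sigma>. \<sigma> permutes {1..n}}))"

definition minimal_scheme ::
  "'w measure \<Rightarrow> ('w \<Rightarrow> ('a::euclidean_space \<times> 'a) measure) \<Rightarrow> bool" where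
  "minimal_scheme P M \<longleftrightarrow> (AE w in P. minimal_edges (support (M w)))"

definition crosses :: "'a::euclidean_space \<times> 'a \<Rightarrow> 'a set \<Rightarrow> bool" where
  "crosses e S \<longleftrightarrow> closed_segment (fst e) (snd e) \<inter> S \<noteq> {}"

text \<open>This concerns segments crossing bounded subsets of the base space; it is much stronger
  than local finiteness of \<open>M\<close> as a measure on pairs, which every point process has.\<close>

definition locally_finite_scheme ::
  "'w measure \<Rightarrow> ('w \<Rightarrow> ('a::euclidean_space \<times> 'a) measure) \<Rightarrow> bool" where
  "locally_finite_scheme P M \<longleftrightarrow>
    (AE w in P. \<forall>S. bounded S \<longrightarrow> finite {e \<in> support (M w). crosses e S})"

end

theory Submission imports Defs
begin

text \<open>
  The heart of the matter is deterministic. Suppose that infinitely many edges \<open>(r\<^sub>n, b\<^sub>n)\<close> of a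
  minimal matching between two locally finite sets cross a bounded set. Both endpoints escape to
  infinity, and along a subsequence the directions of these edges converge to a unit vector \<open>u\<close>.
  Take any edge \<open>(r, b)\<close> and compare the pair \<open>(r, b)\<close>, \<open>(r\<^sub>n, b\<^sub>n)\<close> with the exchanged pair
  \<open>(r, b\<^sub>n)\<close>, \<open>(r\<^sub>n, b)\<close>. Seen from infinity, distances become linear (Busemann) functions, so in
  the limit the minimality inequality reads \<open>norm (b - r) \<le> u \<bullet> (b - r)\<close>. This is the equality case
  of the Cauchy--Schwarz inequality: every edge of the matching points in the direction \<open>u\<close>
  (\<open>minimal_matching_parallel\<close>).

  For independent Poisson processes in dimension at least two this is impossible. Two distinct edges
  would give distinct red points \<open>r1\<close>, \<open>r2\<close> and distinct blue points \<open>b1\<close>, \<open>b2\<close> with \<open>b2 - r2\<close> a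
  multiple of \<open>b1 - r1\<close>. Such quadruples form a Lebesgue null set, since they are parametrised by
  only \<open>3 d + 1 < 4 d\<close> real numbers (\<open>negligible_parallel_quadruples\<close>), and almost surely no
  quadruple of distinct Poisson points lies in a given null set
  (\<open>poisson_quadruple_avoids_null_set\<close>).
\<close>

section \<open>Minimal matchings with infinitely many edges near a point\<close>

lemma minimal_edges_exchange:
  assumes "minimal_edges E" "(r, b) \<in> E" "(r', b') \<in> E" "(r, b) \<noteq> (r', b')"
  shows "norm (r - b) + norm (r' - b') \<le> norm (r - b') + norm (r' - b)"
proof -
  define rs where "rs i = (if i = (1::nat) then r else r')" for i
  define bs where "bs i = (if i = (1::nat) then b else b')" for i
  let ?c = "\<lambda>\<sigma>. \<Sum>i=1..2. norm (rs i - bs (\<sigma> i))"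
  let ?S = "{\<sigma>. \<sigma> permutes {1..2::nat}}"
  have I: "{1..2::nat} = {1, 2}" by auto
  have "inj_on (\<lambda>i. (rs i, bs i)) {1..2}" "\<forall>i\<in>{1..2}. (rs i, bs i) \<in> E"
    unfolding I using assms by (auto simp: rs_def bs_def)
  then have "(\<Sum>i=1..2. norm (rs i - bs i)) = Min (?c ` ?S)"
    using assms(1) unfolding minimal_edges_def by blast
  also have "\<dots> \<le> ?c (Transposition.transpose 1 2)"
    by (intro Min_le finite_imageI finite_permutations imageI)
       (auto intro!: permutes_swap_id)
  finally show ?thesis
    unfolding I by (simp add: rs_def bs_def)
qed

text \<open>This quantifies how the distance to a point far away in direction \<open>u\<close> becomes linear. It comes
  from \<open>2 * s * norm v \<le> s\<^sup>2 + (norm v)\<^sup>2\<close>, which loses little because \<open>norm v\<close> is close to \<open>s\<close>.\<close>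

lemma norm_add_scaleR_le:
  fixes u q :: "'a::euclidean_space"
  assumes "norm u = 1" "s > 0"
  shows "norm (s *\<^sub>R u + q) \<le> s + u \<bullet> q + (norm q)\<^sup>2 / (2 * s)"
proof -
  let ?v = "s *\<^sub>R u + q"
  have uu: "u \<bullet> u = 1"
    using assms(1) by (simp add: dot_square_norm)
  have "2 * s * norm ?v \<le> s\<^sup>2 + (norm ?v)\<^sup>2"
    using sum_squares_bound[of s "norm ?v"] by simp
  also have "(norm ?v)\<^sup>2 = s\<^sup>2 + 2 * s * (u \<bullet> q) + (norm q)\<^sup>2"
    unfolding power2_norm_eq_inner
    by (simp add: inner_add_left inner_add_right uu inner_commute[of q u] power2_eq_square distrib_left)
  finally have "norm ?v \<le> (2 * s * s + 2 * s * (u \<bullet> q) + (norm q)\<^sup>2) / (2 * s)"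
    using assms(2) by (simp add: pos_le_divide_eq power2_eq_square algebra_simps)
  also have "\<dots> = s + u \<bullet> q + (norm q)\<^sup>2 / (2 * s)"
    using assms(2) by (simp add: field_simps)
  finally show ?thesis .
qed

lemma injective_sequence_norm_at_top:
  fixes f :: "nat \<Rightarrow> 'a::real_normed_vector"
  assumes "inj f" "range f \<subseteq> V" "\<And>A. bounded A \<Longrightarrow> finite (V \<inter> A)"
  shows "filterlim (\<lambda>n. norm (f n)) at_top sequentially"
  unfolding filterlim_at_top
proof
  fix Z :: real
  have "finite (f -` (V \<inter> cball 0 Z))"
    by (rule finite_vimageI[OF assms(3)[OF bounded_cball] assms(1)])
  then have "finite {n. \<not> Z \<le> norm (f n)}"
    by (rule rev_finite_subset) (use assms(2) in auto)
  then show "\<forall>\<^sub>F n in sequentially. Z \<le> norm (f n)"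
    by (simp add: eventually_cofinite flip: cofinite_eq_sequentially)
qed

lemma matching_edge_unique:
  assumes "perfect_matching V W E" "e \<in> E" "e' \<in> E"
    "v \<in> V \<union> W" "v = fst e \<or> v = snd e" "v = fst e' \<or> v = snd e'"
  shows "e = e'"
proof -
  have "card {e \<in> E. v = fst e \<or> v = snd e} = 1"
    using assms(1,4) unfolding perfect_matching_def by blast
  then obtain x where "{e \<in> E. v = fst e \<or> v = snd e} = {x}"
    using card_1_singletonE by metis
  moreover have "e \<in> {e \<in> E. v = fst e \<or> v = snd e}" "e' \<in> {e \<in> E. v = fst e \<or> v = snd e}"
    using assms by blast+
  ultimately show ?thesis by simp
qed

text \<open>What exchanging partners with a long edge through \<open>p\<close> of direction \<open>u\<close> reveals about a fixed
  edge: the lengths \<open>s\<close> and \<open>t\<close> of the two halves cancel, and so does \<open>p\<close>, up to terms that vanish as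
  \<open>s\<close> and \<open>t\<close> grow.\<close>

lemma far_edge_exchange:
  fixes r b r' b' p u :: "'a::euclidean_space"
  assumes ex: "norm (r - b) + norm (r' - b') \<le> norm (r - b') + norm (r' - b)"
    and u: "norm u = 1" and s: "s > 0" "b' = p + s *\<^sub>R u" and t: "t > 0" "r' = p - t *\<^sub>R u"
  shows "norm (r - b) \<le> u \<bullet> (b - r) + (norm (p - r))\<^sup>2 / (2 * s) + (norm (b - p))\<^sup>2 / (2 * t)"
proof -
  have "norm (r' - b') = s + t"
  proof -
    have "b' - r' = (s + t) *\<^sub>R u" using s t by (simp add: algebra_simps)
    then show ?thesis using u s t by (simp add: norm_minus_commute)
  qed
  moreover have "norm (r - b') \<le> s + u \<bullet> (p - r) + (norm (p - r))\<^sup>2 / (2 * s)"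
  proof -
    have "norm (r - b') = norm (s *\<^sub>R u + (p - r))"
      unfolding s(2) by (subst norm_minus_commute) (simp add: algebra_simps)
    then show ?thesis using norm_add_scaleR_le[OF u s(1), of "p - r"] by simp
  qed
  moreover have "norm (r' - b) \<le> t + u \<bullet> (b - p) + (norm (b - p))\<^sup>2 / (2 * t)"
  proof -
    have "norm (r' - b) = norm (t *\<^sub>R u + (b - p))"
      unfolding t(2) by (subst norm_minus_commute) (simp add: algebra_simps)
    then show ?thesis using norm_add_scaleR_le[OF u t(1), of "b - p"] by simp
  qed
  ultimately show ?thesis
    using ex by (simp add: inner_diff_right)
qed

text \<open>The limiting direction of the infinitely many crossing edges dictates the direction of every
  edge, however short and wherever it lies.\<close>

lemma minimal_matching_parallel:
  fixes E :: "('a::euclidean_space \<times> 'a) set"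
  assumes pm: "perfect_matching V W E" and min: "minimal_edges E"
    and V: "\<And>A. bounded A \<Longrightarrow> finite (V \<inter> A)" and W: "\<And>A. bounded A \<Longrightarrow> finite (W \<inter> A)"
    and S: "bounded S" and inf: "infinite {e \<in> E. crosses e S}"
  obtains u where "norm u = 1" "\<And>r b. (r, b) \<in> E \<Longrightarrow> b - r = norm (b - r) *\<^sub>R u"
proof -
  obtain e :: "nat \<Rightarrow> 'a \<times> 'a" where e: "inj e" "range e \<subseteq> {e \<in> E. crosses e S}"
    using infinite_countable_subset[OF inf] by blast
  have eE: "e n \<in> E" for n using e by auto
  define rs where "rs n = fst (e n)" for n
  define bs where "bs n = snd (e n)" for n
  have EVW: "E \<subseteq> V \<times> W" using pm by (auto simp: perfect_matching_def)
  have VW: "rs n \<in> V" "bs n \<in> W" for n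
    using eE[of n] EVW by (auto simp: rs_def bs_def)
  have "inj rs"
  proof (rule injI)
    fix m n assume "rs m = rs n"
    then have "e m = e n"
      using matching_edge_unique[OF pm eE eE, of "rs m" m n] VW by (auto simp: rs_def)
    then show "m = n" using e(1) by (simp add: inj_eq)
  qed
  have "inj bs"
  proof (rule injI)
    fix m n assume "bs m = bs n"
    then have "e m = e n"
      using matching_edge_unique[OF pm eE eE, of "bs m" m n] VW by (auto simp: bs_def)
    then show "m = n" using e(1) by (simp add: inj_eq)
  qed
  have "\<exists>p. p \<in> S \<and> p \<in> closed_segment (rs n) (bs n)" for n
    using e(2) by (force simp: crosses_def rs_def bs_def)
  then obtain p where p: "\<And>n. p n \<in> S" "\<And>n. p n \<in> closed_segment (rs n) (bs n)"
    by metis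
  define s where "s n = norm (bs n - p n)" for n
  define t where "t n = norm (p n - rs n)" for n
  define u where "u n = sgn (bs n - rs n)" for n
  obtain K where K: "\<And>x. x \<in> S \<Longrightarrow> norm x \<le> K"
    using S by (auto simp: bounded_iff)
  have disj: "rs n \<noteq> bs n" for n
    using VW[of n] pm by (auto simp: perfect_matching_def)
  have nu: "norm (u n) = 1" for n
    using disj[of n] by (simp add: u_def norm_sgn)
  have bs_eq: "bs n = p n + s n *\<^sub>R u n" and rs_eq: "rs n = p n - t n *\<^sub>R u n" for n
  proof -
    obtain a where a: "0 \<le> a" "a \<le> 1" "p n = rs n + a *\<^sub>R (bs n - rs n)"
      using p(2)[of n] by (auto simp: closed_segment_def algebra_simps)
    have *: "bs n - p n = (1 - a) *\<^sub>R (bs n - rs n)" "p n - rs n = a *\<^sub>R (bs n - rs n)"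
      using a by (auto simp: algebra_simps)
    have d: "bs n - rs n = norm (bs n - rs n) *\<^sub>R u n"
      using disj[of n] by (simp add: u_def sgn_div_norm)
    have "s n *\<^sub>R u n = bs n - p n"
      unfolding s_def * using a d by (metis abs_of_nonneg diff_ge_0_iff_ge norm_scaleR scaleR_scaleR)
    then show "bs n = p n + s n *\<^sub>R u n" by simp
    have "t n *\<^sub>R u n = p n - rs n"
      unfolding t_def * using a d by (metis abs_of_nonneg norm_scaleR scaleR_scaleR)
    then show "rs n = p n - t n *\<^sub>R u n" by simp
  qed
  \<comment> \<open>\<open>p n\<close> stays in a ball of radius \<open>K\<close> while distinct endpoints leave every ball.\<close>
  have s_top: "filterlim s at_top sequentially"
  proof (rule filterlim_at_top_mono)
    show "filterlim (\<lambda>n. - K + norm (bs n)) at_top sequentially"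
      by (intro filterlim_tendsto_add_at_top[OF tendsto_const]
          injective_sequence_norm_at_top[OF \<open>inj bs\<close> _ W]) (use VW in auto)
    show "\<forall>\<^sub>F n in sequentially. - K + norm (bs n) \<le> s n"
      using norm_triangle_ineq2[of "bs _" "p _"] K[OF p(1)] unfolding s_def
      by (intro always_eventually allI) (smt (verit, best))
  qed
  have t_top: "filterlim t at_top sequentially"
  proof (rule filterlim_at_top_mono)
    show "filterlim (\<lambda>n. - K + norm (rs n)) at_top sequentially"
      by (intro filterlim_tendsto_add_at_top[OF tendsto_const]
          injective_sequence_norm_at_top[OF \<open>inj rs\<close> _ V]) (use VW in auto)
    show "\<forall>\<^sub>F n in sequentially. - K + norm (rs n) \<le> t n"
      using norm_triangle_ineq2[of "rs _" "p _"] K[OF p(1)] unfolding t_def norm_minus_commute[of "p _"]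
      by (intro always_eventually allI) (smt (verit, best))
  qed
  have "seq_compact (sphere 0 1 :: 'a set)"
    using compact_imp_seq_compact compact_sphere by blast
  then obtain l \<phi> where l: "norm l = 1" and \<phi>: "strict_mono (\<phi> :: nat \<Rightarrow> nat)"
    and lim: "(\<lambda>n. u (\<phi> n)) \<longlonglongrightarrow> l"
    using nu by (elim seq_compactE[where f = u]) (auto simp: o_def)
  have \<phi>_lim: "filterlim \<phi> sequentially sequentially"
    by (rule filterlim_subseq[OF \<phi>])
  show thesis
  proof
    show "norm l = 1" by fact
    fix r b assume rb: "(r, b) \<in> E"
    let ?C = "(K + norm r)\<^sup>2" and ?D = "(norm b + K)\<^sup>2"
    have lim1: "((\<lambda>n. ?C / (2 * s n) + ?D / (2 * t n)) \<longlongrightarrow> 0 + 0) sequentially"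
      by (intro tendsto_add real_tendsto_divide_at_top[OF tendsto_const]
          filterlim_tendsto_pos_mult_at_top[OF tendsto_const] s_top t_top) simp_all
    have ev: "\<forall>\<^sub>F n in sequentially. norm (r - b) \<le> u n \<bullet> (b - r) + (?C / (2 * s n) + ?D / (2 * t n))"
    proof -
      have "\<forall>\<^sub>F n in sequentially. s n > 0" "\<forall>\<^sub>F n in sequentially. t n > 0"
        using s_top t_top by (auto simp: filterlim_at_top_dense)
      moreover have "\<forall>\<^sub>F n in sequentially. (r, b) \<noteq> e n"
      proof -
        have "finite (e -` {(r, b)})" using e(1) by (intro finite_vimageI) auto
        then have "finite {n. \<not> (r, b) \<noteq> e n}"
          by (rule rev_finite_subset) auto
        then show ?thesis
          by (simp add: eventually_cofinite flip: cofinite_eq_sequentially)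
      qed
      ultimately show ?thesis
      proof eventually_elim
        case (elim n)
        have "norm (r - b) + norm (rs n - bs n) \<le> norm (r - bs n) + norm (rs n - b)"
          using minimal_edges_exchange[OF min rb, of "rs n" "bs n"] eE[of n] elim
          by (simp add: rs_def bs_def)
        from far_edge_exchange[OF this nu elim(1) bs_eq elim(2) rs_eq]
        have "norm (r - b) \<le> u n \<bullet> (b - r) + (norm (p n - r))\<^sup>2 / (2 * s n)
            + (norm (b - p n))\<^sup>2 / (2 * t n)" .
        moreover have "norm (p n - r) \<le> K + norm r" "norm (b - p n) \<le> norm b + K"
          using K[OF p(1)[of n]] norm_triangle_ineq4[of "p n" r] norm_triangle_ineq4[of b "p n"]
          by linarith+
        then have "(norm (p n - r))\<^sup>2 / (2 * s n) \<le> ?C / (2 * s n)"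
          "(norm (b - p n))\<^sup>2 / (2 * t n) \<le> ?D / (2 * t n)"
          using elim by (auto intro!: divide_right_mono power_mono)
        ultimately show ?case by linarith
      qed
    qed
    have "norm (r - b) \<le> l \<bullet> (b - r) + (0 + 0)"
    proof (rule tendsto_lowerbound)
      show "(\<lambda>n. u (\<phi> n) \<bullet> (b - r) + (?C / (2 * s (\<phi> n)) + ?D / (2 * t (\<phi> n)))) 
          \<longlonglongrightarrow> l \<bullet> (b - r) + (0 + 0)"
        by (intro tendsto_add[OF tendsto_inner[OF lim tendsto_const]]
            filterlim_compose[OF lim1 \<phi>_lim])
      show "\<forall>\<^sub>F n in sequentially. norm (r - b) \<le>
          u (\<phi> n) \<bullet> (b - r) + (?C / (2 * s (\<phi> n)) + ?D / (2 * t (\<phi> n)))"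
        using eventually_compose_filterlim[OF ev \<phi>_lim] .
    qed simp
    \<comment> \<open>Equality in Cauchy--Schwarz forces proportionality.\<close>
    then have "l \<bullet> (b - r) = norm l * norm (b - r)"
      using norm_cauchy_schwarz[of l "b - r"] l by (simp add: norm_minus_commute)
    then have "norm l *\<^sub>R (b - r) = norm (b - r) *\<^sub>R l"
      by (simp add: norm_cauchy_schwarz_eq)
    then show "b - r = norm (b - r) *\<^sub>R l"
      using l by simp
  qed
qed


section \<open>Poisson points avoid null sets of quadruples\<close>

lemma measurable_count:
  assumes "A \<in> sets borel"
  shows "(\<lambda>N. emeasure N A) \<in> borel_measurable config_space"
proof -
  let ?G = "{{N \<in> counting_measures. emeasure N A \<in> U} | A U. A \<in> sets borel \<and> U \<in> sets borel}"
  have sub: "?G \<subseteq> Pow counting_measures" by auto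
  show ?thesis
  proof (rule measurableI)
    fix U :: "ennreal set" assume "U \<in> sets borel"
    moreover have "(\<lambda>N. emeasure N A) -` U \<inter> space config_space
        = {N \<in> counting_measures. emeasure N A \<in> U}"
      unfolding config_space_def space_measure_of[OF sub] by auto
    ultimately show "(\<lambda>N. emeasure N A) -` U \<inter> space config_space \<in> sets config_space"
      unfolding config_space_def sets_measure_of[OF sub] using assms by auto
  qed simp
qed

lemma point_process_counting:
  assumes "point_process P N" "w \<in> space P"
  shows "sets (N w) = sets borel"
    "\<And>A. A \<in> sets borel \<Longrightarrow> bounded A \<Longrightarrow> \<exists>k::nat. emeasure (N w) A = of_nat k"
proof -
  have "space config_space = (counting_measures :: 'b measure set)"
    unfolding config_space_def by (subst space_measure_of) auto
  then have "N w \<in> counting_measures"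
    using measurable_space[of N P config_space w] assms by (simp add: point_process_def)
  then show "sets (N w) = sets borel"
    "\<And>A. A \<in> sets borel \<Longrightarrow> bounded A \<Longrightarrow> \<exists>k::nat. emeasure (N w) A = of_nat k"
    by (auto simp: counting_measures_def)
qed

lemma support_locally_finite:
  fixes N :: "'w \<Rightarrow> 'a::euclidean_space measure"
  assumes "point_process P N" "w \<in> space P" "bounded A"
  shows "finite (support (N w) \<inter> A)"
proof -
  obtain C where C: "A \<subseteq> cball 0 C"
    using bounded_subset_ballD[OF assms(3), of 0] ball_subset_cball by blast
  obtain k :: nat where k: "emeasure (N w) (cball 0 C) = of_nat k"
    using point_process_counting(2)[OF assms(1,2), of "cball 0 C"] by auto
  note sets = point_process_counting(1)[OF assms(1,2)]
  have "card F \<le> k" if F: "finite F" "F \<subseteq> support (N w) \<inter> A" for F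
  proof -
    have "of_nat (card F) = (\<Sum>x\<in>F. emeasure (N w) {x})"
      using F(2) by (subst sum.cong[OF refl, of F _ "\<lambda>_. 1"]) (auto simp: support_def)
    also have "\<dots> = emeasure (N w) F"
      using F(1) by (subst emeasure_eq_sum_singleton) (auto simp: sets)
    also have "\<dots> \<le> emeasure (N w) (cball 0 C)"
      using F C by (intro emeasure_mono) (auto simp: sets)
    finally show ?thesis by (simp add: k)
  qed
  then show ?thesis
    using finite_if_finite_subsets_card_bdd by (metis (no_types, lifting))
qed

lemma support_imp_hit:
  assumes "point_process P N" "w \<in> space P" "x \<in> support (N w)" "x \<in> A" "A \<in> sets borel"
  shows "emeasure (N w) A \<noteq> 0"
proof -
  have "emeasure (N w) {x} \<le> emeasure (N w) A"
    using assms point_process_counting(1)[OF assms(1,2)] by (intro emeasure_mono) auto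
  then show ?thesis using assms(3) by (auto simp: support_def)
qed

text \<open>The exact probability is \<open>1 - exp (- v)\<close> for a set of volume \<open>v\<close>. The linear bound turns
  covering estimates for Lebesgue measure into probability estimates.\<close>

lemma poisson_hit_le:
  assumes "prob_space P" "poisson_process P 1 N" "A \<in> sets borel" "emeasure lborel A < \<infinity>"
  shows "measure P {w \<in> space P. emeasure (N w) A \<noteq> 0} \<le> measure lborel A"
proof -
  interpret prob_space P by fact
  have N: "N \<in> measurable P config_space"
    using assms(2) by (simp add: poisson_process_def point_process_def)
  have [measurable]: "(\<lambda>w. emeasure (N w) A) \<in> borel_measurable P"
    by (rule measurable_compose[OF N measurable_count[OF assms(3)]])
  have "prob {w \<in> space P. emeasure (N w) A = of_nat 0} =
      exp (- (1 * measure lborel A)) * (1 * measure lborel A) ^ 0 / fact 0"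
    using assms(2,3,4) unfolding poisson_process_def by blast
  then have "prob {w \<in> space P. emeasure (N w) A = 0} = exp (- measure lborel A)"
    by simp
  moreover have "prob {w \<in> space P. \<not> emeasure (N w) A = 0} = 1 - prob {w \<in> space P. emeasure (N w) A = 0}"
    by (rule prob_neg) measurable
  ultimately show ?thesis
    using exp_ge_add_one_self[of "- measure lborel A"] by simp
qed

lemma poisson_hit_two_le:
  assumes "prob_space P" "poisson_process P 1 N"
    and A: "A \<in> sets borel" "emeasure lborel A < \<infinity>"
    and B: "B \<in> sets borel" "emeasure lborel B < \<infinity>"
    and disj: "A \<inter> B = {}"
  shows "measure P {w \<in> space P. emeasure (N w) A \<noteq> 0 \<and> emeasure (N w) B \<noteq> 0}
    \<le> measure lborel A * measure lborel B"
proof -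
  interpret prob_space P by fact
  define C where "C i = (if i = (0::nat) then A else B)" for i
  have I: "{..<2::nat} = {0, 1}" by auto
  have "disjoint_family_on C {..<2}"
    unfolding I using disj by (auto simp: disjoint_family_on_def C_def)
  moreover have "\<forall>i<2. C i \<in> sets borel" using A B by (simp add: C_def)
  ultimately have "indep_vars (\<lambda>_. borel) (\<lambda>i w. emeasure (N w) (C i)) {..<2}"
    using assms(2) unfolding poisson_process_def by blast
  from indep_varsD_finite[OF this, of "\<lambda>_. - {0}"]
  have "prob (\<Inter>i\<in>{0,1::nat}. (\<lambda>w. emeasure (N w) (C i)) -` (- {0}) \<inter> space P) =
    (\<Prod>i\<in>{0,1::nat}. prob ((\<lambda>w. emeasure (N w) (C i)) -` (- {0}) \<inter> space P))"
    by (simp add: I)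
  moreover have "(\<lambda>w. emeasure (N w) D) -` (- {0}) \<inter> space P = {w \<in> space P. emeasure (N w) D \<noteq> 0}" for D
    by auto
  moreover have "(\<Inter>i\<in>{0,1::nat}. {w \<in> space P. emeasure (N w) (C i) \<noteq> 0})
      = {w \<in> space P. emeasure (N w) A \<noteq> 0 \<and> emeasure (N w) B \<noteq> 0}"
    by (auto simp: C_def)
  ultimately have "prob {w \<in> space P. emeasure (N w) A \<noteq> 0 \<and> emeasure (N w) B \<noteq> 0} =
      prob {w \<in> space P. emeasure (N w) A \<noteq> 0} * prob {w \<in> space P. emeasure (N w) B \<noteq> 0}"
    by (simp add: C_def)
  also have "\<dots> \<le> measure lborel A * measure lborel B"
    using poisson_hit_le[OF assms(1,2)] A B by (intro mult_mono) auto
  finally show ?thesis .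
qed

text \<open>Counts on disjoint sets are independent within one process, and the two processes are
  independent; hence disjointness is needed only between sets examined by the same process.\<close>

lemma independent_poisson_hit_four_le:
  fixes R B :: "'w \<Rightarrow> 'a::euclidean_space measure"
  assumes P: "prob_space P" "poisson_process P 1 R" "poisson_process P 1 B"
    and indep: "prob_space.indep_var P config_space R config_space B"
    and fin: "\<And>i. i < 4 \<Longrightarrow> C i \<in> sets borel \<and> emeasure lborel (C i) < \<infinity>"
    and disj: "C 0 \<inter> C 1 = {}" "C 2 \<inter> C (3::nat) = {}"
  shows "measure P {w \<in> space P. (emeasure (R w) (C 0) \<noteq> 0 \<and> emeasure (R w) (C 1) \<noteq> 0) \<and>
      (emeasure (B w) (C 2) \<noteq> 0 \<and> emeasure (B w) (C 3) \<noteq> 0)}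
    \<le> (measure lborel (C 0) * measure lborel (C 1)) * (measure lborel (C 2) * measure lborel (C 3))"
proof -
  interpret prob_space P by fact
  let ?X = "\<lambda>A B. {N \<in> space config_space. emeasure N A \<noteq> 0 \<and> emeasure N B \<noteq> (0::ennreal)}"
  have X: "?X A A' \<in> sets config_space"
    if "A \<in> sets borel" "A' \<in> sets borel" for A A' :: "'a set"
  proof -
    note [measurable] = measurable_count[OF that(1)] measurable_count[OF that(2)]
    show ?thesis by measurable
  qed
  have sp: "R w \<in> space config_space" "B w \<in> space config_space" if "w \<in> space P" for w
    using P(2,3) that by (auto simp: poisson_process_def point_process_def dest: measurable_space)
  let ?W = "\<lambda>N A A'. {w \<in> space P. emeasure (N w) A \<noteq> 0 \<and> emeasure (N w) A' \<noteq> (0::ennreal)}"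
  have "prob ((\<lambda>w. (R w, B w)) -` (?X (C 0) (C 1) \<times> ?X (C 2) (C 3)) \<inter> space P)
      = prob (R -` ?X (C 0) (C 1) \<inter> space P) * prob (B -` ?X (C 2) (C 3) \<inter> space P)"
    using fin by (intro indep_varD[OF indep] X) auto
  also have "R -` ?X (C 0) (C 1) \<inter> space P = ?W R (C 0) (C 1)" using sp by auto
  also have "B -` ?X (C 2) (C 3) \<inter> space P = ?W B (C 2) (C 3)" using sp by auto
  also have "(\<lambda>w. (R w, B w)) -` (?X (C 0) (C 1) \<times> ?X (C 2) (C 3)) \<inter> space P
    = {w \<in> space P. (emeasure (R w) (C 0) \<noteq> 0 \<and> emeasure (R w) (C 1) \<noteq> 0) \<and>
      (emeasure (B w) (C 2) \<noteq> 0 \<and> emeasure (B w) (C 3) \<noteq> 0)}" using sp by auto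
  also have "prob (?W R (C 0) (C 1)) * prob (?W B (C 2) (C 3)) \<le>
      (measure lborel (C 0) * measure lborel (C 1)) * (measure lborel (C 2) * measure lborel (C 3))"
    using fin disj by (intro mult_mono poisson_hit_two_le P) auto
  finally show ?thesis .
qed

text \<open>Boxes, rather than arbitrary sets of small measure, are needed because a box in a product space
  is a product of boxes, to which the hitting bound for four sets applies. The bound is on the sum of
  the volumes, which the non-overlapping of the boxes gives.\<close>

lemma negligible_cover_small_boxes:
  fixes S :: "'n::euclidean_space set"
  assumes "negligible S" "bounded S" "e > 0"
  obtains D where "countable D" "\<And>K. K \<in> D \<Longrightarrow> \<exists>c d. K = cbox c d" "S \<subseteq> \<Union>D"
    "\<And>F. finite F \<Longrightarrow> F \<subseteq> D \<Longrightarrow> (\<Sum>K\<in>F. measure lborel K) \<le> e"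
proof -
  obtain a b where ab: "S \<subseteq> cbox a b"
    using assms(2) bounded_subset_cbox_symmetric by blast
  have S: "S \<in> lmeasurable" "measure lebesgue S = 0"
    using assms(1) negligible_iff_measure by blast+
  obtain D where D: "countable D"
      "\<And>K. K \<in> D \<Longrightarrow> K \<subseteq> cbox a b \<and> K \<noteq> {} \<and> (\<exists>c d. K = cbox c d)"
      "pairwise (\<lambda>A B. interior A \<inter> interior B = {}) D"
      "S \<subseteq> \<Union>D" "\<Union>D \<in> lmeasurable" "measure lebesgue (\<Union>D) \<le> measure lebesgue S + e"
    using measurable_outer_intervals_bounded[OF S(1) ab assms(3)] by metis
  have "(\<Sum>K\<in>F. measure lborel K) \<le> e" if F: "finite F" "F \<subseteq> D" for F
  proof -
    have lm: "K \<in> lmeasurable" if "K \<in> F" for K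
      using D(2)[of K] F that by auto
    have "(\<Sum>K\<in>F. measure lborel K) = (\<Sum>K\<in>F. measure lebesgue K)"
      using D(2) F by (intro sum.cong refl) (metis cbox_borel measure_completion sets_lborel subsetD)
    also have "\<dots> = measure lebesgue (\<Union>F)"
    proof (rule measure_negligible_finite_Union[symmetric])
      show "pairwise (\<lambda>S T. negligible (S \<inter> T)) F"
      proof (rule pairwiseI)
        fix K L assume KL: "K \<in> F" "L \<in> F" "K \<noteq> L"
        then have "interior (K \<inter> L) = {}"
          using D(3) F(2) by (auto simp: pairwise_def)
        moreover obtain c d c' d' where "K = cbox c d" "L = cbox c' d'"
          using D(2) KL F(2) by (meson subsetD)
        ultimately show "negligible (K \<inter> L)"
          using negligible_convex_interior[of "K \<inter> L"] by (simp add: convex_Int)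
      qed
    qed (use F lm in auto)
    also have "\<dots> \<le> measure lebesgue (\<Union>D)"
      using F D(5) lm by (intro measure_mono_fmeasurable) auto
    finally show ?thesis using D(6) S(2) by simp
  qed
  then show ?thesis using that[of D] D(1,2,4) by blast
qed

text \<open>Cover the null set by boxes of small total volume. Intersecting the sides of each box with the
  sets \<open>A i\<close> makes them disjoint where independence asks for it, and the union bound over the
  boxes then gives the covering event.\<close>

lemma poisson_quadruple_in_null_set_small:
  fixes R B :: "'w \<Rightarrow> 'a::euclidean_space measure" and S :: "('a \<times> 'a \<times> 'a \<times> 'a) set"
  assumes P: "prob_space P" "poisson_process P 1 R" "poisson_process P 1 B"
    and indep: "prob_space.indep_var P config_space R config_space B"
    and S: "negligible S" "bounded S"
    and A: "\<And>i. i < 4 \<Longrightarrow> A i \<in> sets borel" "A 0 \<inter> A 1 = {}" "A 2 \<inter> A (3::nat) = {}"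
    and e: "e > 0"
  obtains F where "F \<in> sets P" "measure P F \<le> e"
    "{w \<in> space P. \<exists>r1\<in>support (R w) \<inter> A 0. \<exists>r2\<in>support (R w) \<inter> A 1.
        \<exists>b1\<in>support (B w) \<inter> A 2. \<exists>b2\<in>support (B w) \<inter> A 3. (r1, r2, b1, b2) \<in> S} \<subseteq> F"
proof -
  interpret prob_space P by fact
  obtain D where D: "countable D" "\<And>K. K \<in> D \<Longrightarrow> \<exists>c d. K = cbox c d" "S \<subseteq> \<Union>D"
    "\<And>F. finite F \<Longrightarrow> F \<subseteq> D \<Longrightarrow> (\<Sum>K\<in>F. measure lborel K) \<le> e"
    using negligible_cover_small_boxes[OF S e] by metis
  have pp: "point_process P R" "point_process P B"
    using P by (auto simp: poisson_process_def)
  define covers where "covers K H \<longleftrightarrow> H \<in> sets P \<and> measure P H \<le> measure lborel K \<and>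
     (\<forall>w\<in>space P. \<forall>r1\<in>support (R w) \<inter> A 0. \<forall>r2\<in>support (R w) \<inter> A 1.
        \<forall>b1\<in>support (B w) \<inter> A 2. \<forall>b2\<in>support (B w) \<inter> A 3. (r1, r2, b1, b2) \<in> K \<longrightarrow> w \<in> H)" for K H
  have "\<forall>K\<in>D. \<exists>H. covers K H"
  proof
    fix K assume "K \<in> D"
    then obtain c d where "K = cbox c d" using D(2) by blast
    moreover obtain c0 c1 c2 c3 where "c = (c0, c1, c2, c3)" by (metis surj_pair)
    moreover obtain d0 d1 d2 d3 where "d = (d0, d1, d2, d3)" by (metis surj_pair)
    ultimately have Kc: "K = cbox (c0, c1, c2, c3) (d0, d1, d2, d3)"
      by simp
    then have K: "K = cbox c0 d0 \<times> cbox c1 d1 \<times> cbox c2 d2 \<times> cbox c3 d3"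
      "measure lborel K = measure lborel (cbox c0 d0) * (measure lborel (cbox c1 d1) *
        (measure lborel (cbox c2 d2) * measure lborel (cbox c3 d3)))"
      by (simp add: cbox_Pair_eq) (simp only: Kc content_Pair)
    define Q where "Q i = (if i = (0::nat) then cbox c0 d0 else if i = 1 then cbox c1 d1
        else if i = 2 then cbox c2 d2 else cbox c3 d3)" for i
    have Q: "emeasure lborel (Q i) < \<infinity>" "Q i \<in> sets borel" for i
      by (simp_all add: Q_def emeasure_lborel_cbox_finite[unfolded infinity_ennreal_def])
    define C where "C i = A i \<inter> Q i" for i
    have C: "C i \<in> sets borel" if "i < 4" for i
      using A(1)[OF that] Q(2)[of i] by (auto simp: C_def)
    have Cfin: "emeasure lborel (C i) < \<infinity>" for i
      using Q by (auto simp: C_def intro: le_less_trans[OF emeasure_mono[of _ "Q i"]])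
    have Cle: "measure lborel (C i) \<le> measure lborel (Q i)" if "i < 4" for i
      using Q C[OF that] by (intro measure_mono_fmeasurable) (auto simp: C_def fmeasurable_def)
    let ?H = "{w \<in> space P. (emeasure (R w) (C 0) \<noteq> 0 \<and> emeasure (R w) (C 1) \<noteq> 0) \<and>
      (emeasure (B w) (C 2) \<noteq> 0 \<and> emeasure (B w) (C 3) \<noteq> 0)}"
    have meas: "(\<lambda>w. emeasure (R w) (C i)) \<in> borel_measurable P"
      "(\<lambda>w. emeasure (B w) (C i)) \<in> borel_measurable P" if "i < 4" for i
      using pp measurable_compose[OF _ measurable_count[OF C[OF that]]]
      by (auto simp: point_process_def)
    have [measurable]: "(\<lambda>w. emeasure (R w) (C 0)) \<in> borel_measurable P"
      "(\<lambda>w. emeasure (R w) (C 1)) \<in> borel_measurable P"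
      "(\<lambda>w. emeasure (B w) (C 2)) \<in> borel_measurable P"
      "(\<lambda>w. emeasure (B w) (C 3)) \<in> borel_measurable P"
      by (intro meas; simp)+
    have "?H \<in> sets P" by measurable
    moreover have "measure P ?H \<le> measure lborel K"
    proof -
      have "measure P ?H \<le> (measure lborel (C 0) * measure lborel (C 1)) *
          (measure lborel (C 2) * measure lborel (C 3))"
        using A(2,3) C Cfin
        by (intro independent_poisson_hit_four_le[OF P indep]) (auto simp: C_def)
      also have "\<dots> \<le> (measure lborel (Q 0) * measure lborel (Q 1)) *
          (measure lborel (Q 2) * measure lborel (Q 3))"
        by (intro mult_mono Cle) auto
      also have "\<dots> = measure lborel K"
        by (simp add: K(2) Q_def)
      finally show ?thesis .
    qed
    moreover have "w \<in> ?H" if w: "w \<in> space P"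
      "r1 \<in> support (R w) \<inter> A 0" "r2 \<in> support (R w) \<inter> A 1"
      "b1 \<in> support (B w) \<inter> A 2" "b2 \<in> support (B w) \<inter> A 3" "(r1, r2, b1, b2) \<in> K" for w r1 r2 b1 b2
    proof -
      have "r1 \<in> C 0" "r2 \<in> C 1" "b1 \<in> C 2" "b2 \<in> C 3"
        using w by (auto simp: C_def Q_def K(1))
      moreover have "r1 \<in> support (R w)" "r2 \<in> support (R w)" "b1 \<in> support (B w)" "b2 \<in> support (B w)"
        using w by simp_all
      ultimately have "emeasure (R w) (C 0) \<noteq> 0" "emeasure (R w) (C 1) \<noteq> 0"
        "emeasure (B w) (C 2) \<noteq> 0" "emeasure (B w) (C 3) \<noteq> 0"
        by (intro support_imp_hit[OF pp(1) w(1)] support_imp_hit[OF pp(2) w(1)] C; simp)+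
      then show ?thesis using w(1) by simp
    qed
    ultimately have "covers K ?H"
      unfolding covers_def by blast
    then show "\<exists>H. covers K H" ..
  qed
  then obtain H where H: "\<And>K. K \<in> D \<Longrightarrow> covers K (H K)"
    by metis
  have H1: "H K \<in> sets P" "measure P (H K) \<le> measure lborel K" if "K \<in> D" for K
    using H[OF that] by (auto simp: covers_def)
  show thesis
  proof
    show "(\<Union>K\<in>D. H K) \<in> sets P"
      using H1(1) D(1) by (intro sets.countable_UN') auto
    show "measure P (\<Union>K\<in>D. H K) \<le> e"
    proof (rule measure_UN_bound[OF D(1)])
      fix I' assume I': "I' \<subseteq> D" "finite I'"
      have "measure P (\<Union>K\<in>I'. H K) \<le> (\<Sum>K\<in>I'. measure P (H K))"
        using I' H1(1) by (intro measure_UNION_le) auto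
      also have "\<dots> \<le> (\<Sum>K\<in>I'. measure lborel K)"
        using I' H1(2) by (intro sum_mono) auto
      also have "\<dots> \<le> e" using D(4) I' by blast
      finally show "measure P (\<Union>K\<in>I'. H K) \<le> e" .
    qed (use H1(1) in \<open>simp add: fmeasurable_eq_sets\<close>)
    show "{w \<in> space P. \<exists>r1\<in>support (R w) \<inter> A 0. \<exists>r2\<in>support (R w) \<inter> A 1.
        \<exists>b1\<in>support (B w) \<inter> A 2. \<exists>b2\<in>support (B w) \<inter> A 3. (r1, r2, b1, b2) \<in> S} \<subseteq> (\<Union>K\<in>D. H K)"
    proof (rule subsetI, elim CollectE conjE bexE)
      fix w r1 r2 b1 b2
      assume w: "w \<in> space P" "r1 \<in> support (R w) \<inter> A 0" "r2 \<in> support (R w) \<inter> A 1"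
        "b1 \<in> support (B w) \<inter> A 2" "b2 \<in> support (B w) \<inter> A 3" "(r1, r2, b1, b2) \<in> S"
      then obtain K where K: "K \<in> D" "(r1, r2, b1, b2) \<in> K" using D(3) by (meson UnionE subsetD)
      then have "w \<in> H K"
        using H[OF K(1)] w unfolding covers_def by (meson IntI)
      then show "w \<in> (\<Union>K\<in>D. H K)" by (rule UN_I[OF K(1)])
    qed
  qed
qed

lemma (in prob_space) AE_if_small_exceptional_sets:
  assumes "\<And>e. e > 0 \<Longrightarrow> \<exists>F\<in>sets M. measure M F \<le> e \<and> {w \<in> space M. \<not> Q w} \<subseteq> F"
  shows "AE w in M. Q w"
proof -
  have "\<forall>k. \<exists>F. F \<in> sets M \<and> measure M F \<le> 1 / real (Suc k) \<and> {w \<in> space M. \<not> Q w} \<subseteq> F"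
    using assms[of "1 / real (Suc _)"] by auto
  then obtain F where F: "\<And>k. F k \<in> sets M" "\<And>k. measure M (F k) \<le> 1 / real (Suc k)"
    "\<And>k. {w \<in> space M. \<not> Q w} \<subseteq> F k"
    by metis
  have INT: "(\<Inter>k. F k) \<in> sets M" using F(1) by auto
  have "measure M (\<Inter>k. F k) \<le> 1 / real (Suc k)" for k
    by (rule order.trans[OF finite_measure_mono F(2)]) (use F(1) in auto)
  then have "measure M (\<Inter>k. F k) \<le> 0"
    by (intro LIMSEQ_le_const[OF LIMSEQ_Suc[OF lim_1_over_n]]) auto
  then have "(\<Inter>k. F k) \<in> null_sets M"
    using INT by (simp add: null_setsI emeasure_eq_measure measure_le_0_iff)
  then show ?thesis
    by (rule AE_I') (intro INT_greatest F(3))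
qed

text \<open>Distinct points are separated by disjoint members of a countable basis, so only countably many
  choices of separating sets need to be excluded; intersecting with balls reduces to bounded null
  sets.\<close>

lemma poisson_quadruple_avoids_null_set:
  fixes R B :: "'w \<Rightarrow> 'a::euclidean_space measure" and S :: "('a \<times> 'a \<times> 'a \<times> 'a) set"
  assumes P: "prob_space P" "poisson_process P 1 R" "poisson_process P 1 B"
    and indep: "prob_space.indep_var P config_space R config_space B"
    and S: "negligible S"
  shows "AE w in P. \<forall>r1\<in>support (R w). \<forall>r2\<in>support (R w). \<forall>b1\<in>support (B w). \<forall>b2\<in>support (B w).
    r1 \<noteq> r2 \<longrightarrow> b1 \<noteq> b2 \<longrightarrow> (r1, r2, b1, b2) \<notin> S"
proof -
  interpret prob_space P by fact
  obtain \<B> :: "'a set set" where \<B>: "countable \<B>" "topological_basis \<B>"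
    using ex_countable_basis by blast
  define T where "T = {(X, Y). X \<in> \<B> \<and> Y \<in> \<B> \<and> X \<inter> Y = {}}"
  have "T \<subseteq> \<B> \<times> \<B>" by (auto simp: T_def)
  then have T: "countable T"
    using \<B>(1) countable_SIGMA countable_subset by metis
  have separate: "\<exists>(X, Y)\<in>T. x \<in> X \<and> y \<in> Y" if xy: "x \<noteq> y" for x y
  proof -
    obtain U V where UV: "open U" "open V" "x \<in> U" "y \<in> V" "U \<inter> V = {}"
      using hausdorff[OF xy] by blast
    obtain X where X: "X \<in> \<B>" "x \<in> X" "X \<subseteq> U"
      using topological_basisE[OF \<B>(2) UV(1,3)] by blast
    obtain Y where Y: "Y \<in> \<B>" "y \<in> Y" "Y \<subseteq> V"
      using topological_basisE[OF \<B>(2) UV(2,4)] by blast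
    show ?thesis
      using X Y UV(5) by (intro bexI[of _ "(X, Y)"]) (auto simp: T_def)
  qed
  let ?bad = "\<lambda>w X Y X' Y' n. \<exists>r1\<in>support (R w) \<inter> X. \<exists>r2\<in>support (R w) \<inter> Y.
        \<exists>b1\<in>support (B w) \<inter> X'. \<exists>b2\<in>support (B w) \<inter> Y'. (r1, r2, b1, b2) \<in> S \<inter> cball 0 (real n)"
  have local: "AE w in P. \<not> ?bad w X Y X' Y' n" if XY: "(X, Y) \<in> T" "(X', Y') \<in> T" for X Y X' Y' n
  proof -
    define A where "A i = (if i = (0::nat) then X else if i = 1 then Y
        else if i = 2 then X' else Y')" for i
    have op: "open Z" if "Z \<in> \<B>" for Z
      using topological_basis_open[OF \<B>(2) that] .
    have A: "A i \<in> sets borel" for i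
    proof -
      have "X \<in> \<B>" "Y \<in> \<B>" "X' \<in> \<B>" "Y' \<in> \<B>" using XY by (auto simp: T_def)
      then show ?thesis unfolding A_def by (simp add: op borel_open)
    qed
    have neg: "negligible (S \<inter> cball 0 (real n))"
      using S by (rule negligible_subset) auto
    have bd: "bounded (S \<inter> cball 0 (real n))" by (simp add: bounded_Int)
    have AX: "A 0 = X" "A 1 = Y" "A 2 = X'" "A 3 = Y'" by (simp_all add: A_def)
    have d: "A 0 \<inter> A 1 = {}" "A 2 \<inter> A 3 = {}"
      unfolding AX using XY by (simp_all add: T_def)
    show ?thesis
    proof (rule AE_if_small_exceptional_sets)
      fix e :: real assume e: "e > 0"
      obtain F where F: "F \<in> sets P" "measure P F \<le> e"
        "{w \<in> space P. \<exists>r1\<in>support (R w) \<inter> A 0. \<exists>r2\<in>support (R w) \<inter> A 1.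
          \<exists>b1\<in>support (B w) \<inter> A 2. \<exists>b2\<in>support (B w) \<inter> A 3.
            (r1, r2, b1, b2) \<in> S \<inter> cball 0 (real n)} \<subseteq> F"
        by (rule poisson_quadruple_in_null_set_small
            [where A = A and S = "S \<inter> cball 0 (real n)", OF P indep neg bd _ d e]) (rule A)
      show "\<exists>F\<in>sets P. measure P F \<le> e \<and> {w \<in> space P. \<not> \<not> ?bad w X Y X' Y' n} \<subseteq> F"
        unfolding not_not by (intro bexI[of _ F] conjI F(1,2) F(3)[unfolded AX])
    qed
  qed
  have "AE w in P. \<forall>p\<in>T. \<forall>q\<in>T. \<forall>n. \<not> ?bad w (fst p) (snd p) (fst q) (snd q) n"
  proof (intro AE_ball_countable'[OF _ T], subst AE_all_countable, intro allI)
    fix p q n assume "p \<in> T" "q \<in> T"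
    then show "AE w in P. \<not> ?bad w (fst p) (snd p) (fst q) (snd q) n"
      by (intro local) simp_all
  qed
  then show ?thesis
  proof eventually_elim
    case (elim w)
    show ?case
    proof (intro ballI impI notI)
      fix r1 r2 b1 b2
      assume rb: "r1 \<in> support (R w)" "r2 \<in> support (R w)" "b1 \<in> support (B w)" "b2 \<in> support (B w)"
        "r1 \<noteq> r2" "b1 \<noteq> b2" "(r1, r2, b1, b2) \<in> S"
      obtain X Y where "(X, Y) \<in> T" "r1 \<in> X" "r2 \<in> Y" using separate[OF rb(5)] by blast
      moreover obtain X' Y' where "(X', Y') \<in> T" "b1 \<in> X'" "b2 \<in> Y'" using separate[OF rb(6)] by blast
      moreover obtain n :: nat where "norm (r1, r2, b1, b2) \<le> n" using real_arch_simple by blast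
      ultimately show False
      proof -
        assume a: "(X, Y) \<in> T" "r1 \<in> X" "r2 \<in> Y" "(X', Y') \<in> T" "b1 \<in> X'" "b2 \<in> Y'"
          "norm (r1, r2, b1, b2) \<le> n"
        have "\<not> ?bad w X Y X' Y' n"
          using elim a(1,4) by (metis fst_conv snd_conv)
        moreover have "(r1, r2, b1, b2) \<in> S \<inter> cball 0 (real n)"
          using rb(7) a(7) by (simp only: IntI mem_cball_0)
        ultimately show False using rb(1-4) a by (meson IntI)
      qed
    qed
  qed
qed

section \<open>Parallel edges and local finiteness\<close>

text \<open>The set is the smooth image of a space of dimension \<open>3 d + 1\<close>: the points \<open>r1\<close>, \<open>r2\<close>, \<open>b1\<close> and
  the scalar \<open>c\<close> determine \<open>b2\<close>.\<close>

lemma negligible_parallel_quadruples: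
  assumes "DIM('a::euclidean_space) \<ge> 2"
  shows "negligible {(r1, r2, b1, b2 :: 'a). \<exists>c::real. b2 - r2 = c *\<^sub>R (b1 - r1)}"
proof -
  let ?f = "\<lambda>x :: 'a \<times> 'a \<times> 'a \<times> real. (fst x, fst (snd x), fst (snd (snd x)),
      fst (snd x) + snd (snd (snd x)) *\<^sub>R (fst (snd (snd x)) - fst x))"
  have "negligible (range ?f)"
  proof (rule negligible_differentiable_image_lowdim)
    show "DIM('a \<times> 'a \<times> 'a \<times> real) < DIM('a \<times> 'a \<times> 'a \<times> 'a)"
      using assms by simp
    have deriv: "(?f has_derivative (\<lambda>h. (fst h, fst (snd h), fst (snd (snd h)), fst (snd h) +
        (snd (snd (snd x)) *\<^sub>R (fst (snd (snd h)) - fst h) +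
         snd (snd (snd h)) *\<^sub>R (fst (snd (snd x)) - fst x))))) (at x)" for x
      by (intro derivative_intros)
    have "?f differentiable (at x)" for x
      by (rule differentiableI[OF deriv])
    then show "?f differentiable_on UNIV"
      by (simp add: differentiable_on_def)
  qed
  then show ?thesis
  proof (rule negligible_subset, clarify)
    fix r1 r2 b1 b2 :: 'a and c :: real assume "b2 - r2 = c *\<^sub>R (b1 - r1)"
    then have "(r1, r2, b1, b2) = ?f (r1, r2, b1, c)" by (simp add: algebra_simps)
    then show "(r1, r2, b1, b2) \<in> range ?f" by (rule range_eqI)
  qed
qed

theorem theorem4:
  fixes P :: "'w measure"
    and R B :: "'w \<Rightarrow> 'a::euclidean_space measure"
    and M :: "'w \<Rightarrow> ('a \<times> 'a) measure"
  assumes "DIM('a) \<ge> 2"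
    and "prob_space P"
    and "poisson_process P 1 R"
    and "poisson_process P 1 B"
    and "prob_space.indep_var P config_space R config_space B"
    and "matching_scheme P R B M"
    and "translation_invariant P R B M"
    and "minimal_scheme P M"
  shows "locally_finite_scheme P M"
proof -
  have pp: "point_process P R" "point_process P B"
    using assms(3,4) by (auto simp: poisson_process_def)
  have "AE w in P. perfect_matching (support (R w)) (support (B w)) (support (M w))"
    using assms(6) by (simp add: matching_scheme_def)
  moreover have "AE w in P. minimal_edges (support (M w))"
    using assms(8) by (simp add: minimal_scheme_def)
  moreover note poisson_quadruple_avoids_null_set[OF assms(2-5) negligible_parallel_quadruples[OF assms(1)]]
  moreover note AE_space
  ultimately have "AE w in P. \<forall>S. bounded S \<longrightarrow> finite {e \<in> support (M w). crosses e S}"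
  proof eventually_elim
    case (elim w)
    let ?E = "support (M w)"
    have EVW: "?E \<subseteq> support (R w) \<times> support (B w)" "support (R w) \<inter> support (B w) = {}"
      using elim(1) by (auto simp: perfect_matching_def)
    show ?case
    proof (intro allI impI, rule ccontr)
      fix S :: "'a set" assume S: "bounded S" and inf: "infinite {e \<in> ?E. crosses e S}"
      have fin: "finite (support (R w) \<inter> A)" "finite (support (B w) \<inter> A)" if "bounded A" for A
        using support_locally_finite[OF pp(1) elim(4) that]
          support_locally_finite[OF pp(2) elim(4) that] by simp_all
      obtain u where "norm u = 1" and u: "\<And>r b. (r, b) \<in> ?E \<Longrightarrow> b - r = norm (b - r) *\<^sub>R u"
        by (rule minimal_matching_parallel[OF elim(1,2) fin S inf]) blast+
      have "infinite ?E" using inf by (rule contrapos_nn) simp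
      then obtain e1 where e1: "e1 \<in> ?E" by (metis ex_in_conv finite.emptyI)
      then obtain e2 where e2: "e2 \<in> ?E" "e1 \<noteq> e2"
        using \<open>infinite ?E\<close> finite_subset[of ?E "{e1}"] by blast
      obtain r1 b1 where [simp]: "e1 = (r1, b1)" by (cases e1)
      obtain r2 b2 where [simp]: "e2 = (r2, b2)" by (cases e2)
      have mem: "r1 \<in> support (R w)" "r2 \<in> support (R w)" "b1 \<in> support (B w)" "b2 \<in> support (B w)"
        using e1 e2 EVW(1) by auto
      have "r1 \<noteq> r2"
      proof
        assume "r1 = r2"
        then have "e1 = e2"
          by (intro matching_edge_unique[OF elim(1) e1 e2(1) UnI1[OF mem(1)]]) simp_all
        then show False using e2(2) by contradiction
      qed
      moreover have "b1 \<noteq> b2"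
      proof
        assume "b1 = b2"
        then have "e1 = e2"
          by (intro matching_edge_unique[OF elim(1) e1 e2(1) UnI2[OF mem(3)]]) simp_all
        then show False using e2(2) by contradiction
      qed
      moreover have "b2 - r2 = (norm (b2 - r2) / norm (b1 - r1)) *\<^sub>R (b1 - r1)"
      proof -
        have nz: "norm (b1 - r1) \<noteq> 0" using mem EVW(2) by auto
        have E: "b1 - r1 = norm (b1 - r1) *\<^sub>R u" "b2 - r2 = norm (b2 - r2) *\<^sub>R u"
          using e1 e2(1) by (intro u; simp)+
        have "(norm (b2 - r2) / norm (b1 - r1)) *\<^sub>R (b1 - r1)
            = (norm (b2 - r2) / norm (b1 - r1)) *\<^sub>R (norm (b1 - r1) *\<^sub>R u)"
          by (rule arg_cong[OF E(1)])
        also have "\<dots> = norm (b2 - r2) *\<^sub>R u" using nz by simp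
        also have "\<dots> = b2 - r2" by (rule E(2)[symmetric])
        finally show ?thesis by (rule sym)
      qed
      ultimately show False
        using elim(3)[rule_format, OF mem] by (simp only: mem_Collect_eq case_prod_conv) blast
    qed
  qed
  then show ?thesis by (simp add: locally_finite_scheme_def)
qed

end
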